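(* Let $G$ be a GSOS language. Then for all $P,Q\in\mathbb{T}(\Sigma_G)$, if $P$ and $Q$ are rule-matching bisimilar in $G$ ($P\mathrel{\underline{\leftrightarrow}}^{RM}_G Q$), then $\mathbb{A}(G)\models P=Q$, i.e., $P\sigma\mathrel{\underline{\leftrightarrow}}_G Q\sigma$ for every closed $\Sigma_G$-substitution $\sigma$.
   Context: Let $\mathit{Var}$ be a countably infinite set of variables and $\mathsf{Act}$ a fixed nonempty finite set of actions. A signature $\Sigma$ is a set of operation symbols each with an arity; $\mathbb{T}(\Sigma)$ is the set of terms over $\Sigma$ and $\mathit{Var}$; closed terms have no variables. A GSOS rule over $\Sigma$ has the form $$\frac{\bigcup_{i=1}^{l}\{x_i \xrightarrow{a_{ij}} y_{ij} \mid 1\le j\le m_i\}\ \cup\ \bigcup_{i=1}^{l}\{x_i \not\xrightarrow{b_{ik}} \mid 1\le k\le n_i\}}{f(x_1,\dots,x_l)\xrightarrow{c} C[\vec x,\vec y]}$$ with all variables distinct, $a_{ij},b_{ik},c\in\mathsf{Act}$, $f$ of arity $l$, $C$ a term with variables among $\vec x,\vec y$. A GSOS language $G=(\Sigma_G,R_G)$ is a finite signature with a finite set of GSOS rules; its transition relation $\to_G$ on closed terms is defined by structural induction: $f(\vec p)\xrightarrow{c}_G q$ iff some rule with principal operation $f$ and action $c$ and some closed substitution $\sigma$ with $\sigma(x_i)=p_i$ satisfy all antecedents ($\sigma(x_i)\xrightarrow{a_{ij}}_G\sigma(y_{ij})$; $\sigma(x_i)$ has no $b_{ik}$-transition) and $q=C\sigma$.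 A symmetric relation $\sim$ on closed terms is a bisimulation if $p\sim q$ and $p\xrightarrow{a}_G p'$ imply $q\xrightarrow{a}_G q'$ with $p'\sim q'$ for some $q'$; $\mathrel{\underline{\leftrightarrow}}_G$ is the largest bisimulation. $\mathbb{A}(G)\models P=Q$ means $P\sigma\mathrel{\underline{\leftrightarrow}}_G Q\sigma$ for all closed substitutions $\sigma$. Ruloids: a ruloid for a term $D$ has the shape of a GSOS rule but with source $D$ (all variables distinct); sourcevars are the $x_i$, targetvars the $y_{ij}$; $\mathrm{ante}(\rho)$ is its set of antecedents. It is sound if every closed substitution satisfying its antecedents yields a transition of $\to_G$ when applied to its consequent; a set of ruloids is supporting for $D$ and $c$ if all its consequents are $D\xrightarrow{c}\cdot$ and every closed transition $D[\vec p]\xrightarrow{c}p$ arises by instantiating one of them with a closed substitution satisfying its antecedents. For each term $P$, $\mathrm{ruloids}(P)$ is a fixed finite set of ruloids, the union over $c\in\mathsf{Act}$ of finite sets that are sound and supporting for $P$ and $c$. A ruloid $\rho=\frac{H}{P\xrightarrow{a}P'}$ is valid for $P$ iff $\rho=\rho'\sigma$ for some $\rho'\in\mathrm{ruloids}(P)$ and injective $\sigma:\mathrm{targetvars}(\rho')\to\mathit{Var}\setminus\mathrm{sourcevars}(\rho)$. Initial transition formulae: $F::=\mathsf{True}\mid x\xrightarrow{a}\mid\neg F\mid F\wedge F$; a closed substitution $\sigma$ satisfies $x\xrightarrow{a}$ iff $\sigma(x)\xrightarrow{a}_G p$ for some $p$, connectives as usual; $\models_G F\Rightarrow F'$ iff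 every closed substitution satisfying $F$ satisfies $F'$. For a set $H$ of positive/negative transition formulae, $\mathrm{hyps}(H)$ is the conjunction of $x\xrightarrow{a}$ for each $x\xrightarrow{a}y\in H$ and $\neg(x\xrightarrow{b})$ for each $x\not\xrightarrow{b}\in H$; $\mathrm{hyps}(\rho)=\mathrm{hyps}(\mathrm{ante}(\rho))$ and for a finite set $J$ of ruloids $\mathrm{hyps}(J)=\bigvee_{\rho'\in J}\mathrm{hyps}(\mathrm{ante}(\rho'))$. A symmetric relation $\approx\subseteq\mathbb{T}(\Sigma_G)\times\mathbb{T}(\Sigma_G)$ is a rule-matching bisimulation if $P\approx Q$ implies: for each ruloid $\rho=\frac{H}{P\xrightarrow{a}P'}$ in $\mathrm{ruloids}(P)$ there is a finite set $J$ of valid ruloids for $Q$ such that (1) for every $\rho'=\frac{H'}{Q\xrightarrow{a'}Q'}\in J$: (a) $a'=a$; (b) $P'\approx Q'$; (c) $(\mathrm{targetvars}(\rho')\cup\mathrm{targetvars}(\rho))\cap(\mathrm{sourcevars}(\rho)\cup\mathrm{sourcevars}(\rho'))=\emptyset$; (d) if $y\in\mathrm{targetvars}(\rho)\cap\mathrm{targetvars}(\rho')$ then $x\xrightarrow{b}y\in H\cap H'$ for some $x\in\mathrm{sourcevars}(\rho)\cap\mathrm{sourcevars}(\rho')$ and action $b$; and (2) $\models_G\mathrm{hyps}(\rho)\Rightarrow\mathrm{hyps}(J)$. $P\mathrel{\underline{\leftrightarrow}}^{RM}_G Q$ iff some rule-matching bisimulation relates $P$ and $Q$. Standing assumption: $G$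 contains no junk rules (rules supporting no transition of $\to_G$), and the ruloid sets considered contain no junk ruloids. *)

theory Defs
  imports Main "HOL-Library.Countable" "HOL-Library.Infinite_Typeclass"
begin

section \<open>Terms over a signature\<close>

datatype ('f, 'v) trm = Var 'v | Op 'f "('f, 'v) trm list"

primrec vars :: "('f, 'v) trm \<Rightarrow> 'v set" where
  "vars (Var x) = {x}"
| "vars (Op f ts) = \<Union> (set (map vars ts))"

primrec subst :: "('v \<Rightarrow> ('f, 'w) trm) \<Rightarrow> ('f, 'v) trm \<Rightarrow> ('f, 'w) trm" where
  "subst \<sigma> (Var x) = \<sigma> x"
| "subst \<sigma> (Op f ts) = Op f (map (subst \<sigma>) ts)"

inductive_set terms_over :: "'f set \<Rightarrow> ('f \<Rightarrow> nat) \<Rightarrow> ('f, 'v) trm set"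
  for \<Sigma> :: "'f set" and ar :: "'f \<Rightarrow> nat" where
  "Var x \<in> terms_over \<Sigma> ar"
| "\<lbrakk>f \<in> \<Sigma>; length ts = ar f; \<forall>t \<in> set ts. t \<in> terms_over \<Sigma> ar\<rbrakk> \<Longrightarrow> Op f ts \<in> terms_over \<Sigma> ar"


section \<open>Ruloids and GSOS languages\<close>

datatype ('v, 'a) literal = Pos 'v 'a 'v | Neg 'v 'a

text \<open>
  Rules and ruloids share one representation; a GSOS rule is a ruloid whose source has the form
  \<open>f(x\<^sub>1,\<dots>,x\<^sub>l)\<close> with distinct variables.  For a ruloid with source \<open>D\<close>, the source variables
  \<open>x\<^sub>1,\<dots>,x\<^sub>l\<close> are the variables occurring in \<open>D\<close> (possibly more than once).
\<close>

record ('f, 'v, 'a) ruloid =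
  ante :: "('v, 'a) literal set"
  source :: "('f, 'v) trm"
  label :: 'a
  target :: "('f, 'v) trm"

definition sourcevars :: "('f, 'v, 'a) ruloid \<Rightarrow> 'v set" where
  "sourcevars \<rho> = vars (source \<rho>)"

definition targetvars :: "('f, 'v, 'a) ruloid \<Rightarrow> 'v set" where
  "targetvars \<rho> = {y. \<exists>x a. Pos x a y \<in> ante \<rho>}"

record ('f, 'v, 'a) gsos =
  ops :: "'f set"
  arity :: "'f \<Rightarrow> nat"
  rules :: "('f, 'v, 'a) ruloid set"

abbreviation Terms :: "('f, 'v, 'a) gsos \<Rightarrow> ('f, 'v) trm set" where
  "Terms G \<equiv> terms_over (ops G) (arity G)"

definition closed_terms :: "('f, 'v, 'a) gsos \<Rightarrow> ('f, 'v) trm set" where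
  "closed_terms G = {t \<in> Terms G. vars t = {}}"

definition closed_subst :: "('f, 'v, 'a) gsos \<Rightarrow> ('v \<Rightarrow> ('f, 'v) trm) \<Rightarrow> bool" where
  "closed_subst G \<sigma> \<longleftrightarrow> (\<forall>x. \<sigma> x \<in> closed_terms G)"

text \<open>
  The third and fourth conjuncts of the shape condition are the distinctness of the variables:
  distinct positive antecedents have distinct target variables, and no target variable is a
  source variable.
\<close>

definition ruloid_for :: "('f, 'v, 'a) gsos \<Rightarrow> ('f, 'v) trm \<Rightarrow> ('f, 'v, 'a) ruloid \<Rightarrow> bool" where
  "ruloid_for G D \<rho> \<longleftrightarrow>
     source \<rho> = D \<and>
     finite (ante \<rho>) \<and>
     (\<forall>x a x' a' y. Pos x a y \<in> ante \<rho> \<and> Pos x' a' y \<in> ante \<rho> \<longrightarrow> x = x' \<and> a = a') \<and>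
     sourcevars \<rho> \<inter> targetvars \<rho> = {} \<and>
     (\<forall>x a y. Pos x a y \<in> ante \<rho> \<longrightarrow> x \<in> sourcevars \<rho>) \<and>
     (\<forall>x b. Neg x b \<in> ante \<rho> \<longrightarrow> x \<in> sourcevars \<rho>) \<and>
     target \<rho> \<in> Terms G \<and>
     vars (target \<rho>) \<subseteq> sourcevars \<rho> \<union> targetvars \<rho>"

definition gsos_rule :: "('f, 'v, 'a) gsos \<Rightarrow> ('f, 'v, 'a) ruloid \<Rightarrow> bool" where
  "gsos_rule G \<rho> \<longleftrightarrow>
     (\<exists>f xs. f \<in> ops G \<and> distinct xs \<and> length xs = arity G f \<and>
             ruloid_for G (Op f (map Var xs)) \<rho>)"

definition gsos_language :: "('f, 'v, 'a) gsos \<Rightarrow> bool" where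
  "gsos_language G \<longleftrightarrow>
     finite (ops G) \<and> finite (rules G) \<and> (\<forall>\<rho> \<in> rules G. gsos_rule G \<rho>)"


section \<open>The transition relation and bisimilarity\<close>

text \<open>
  The guards \<open>x \<in> set xs\<close> only serve to make the recursion structural: in a GSOS rule every
  antecedent tests one of the argument variables \<open>xs\<close>.
\<close>

context
  notes conj_cong [fundef_cong]
begin

fun step :: "('f, 'v, 'a) gsos \<Rightarrow> ('f, 'v) trm \<Rightarrow> 'a \<Rightarrow> ('f, 'v) trm \<Rightarrow> bool" where
  "step G (Var x) c q \<longleftrightarrow> False"
| "step G (Op f ps) c q \<longleftrightarrow>
     (\<exists>\<rho> \<in> rules G. \<exists>xs \<sigma>. source \<rho> = Op f (map Var xs) \<and> label \<rho> = c \<and> closed_subst G \<sigma> \<and>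
        ps = map \<sigma> xs \<and>
        (\<forall>x \<in> set xs.
           (\<forall>a y. Pos x a y \<in> ante \<rho> \<longrightarrow> step G (\<sigma> x) a (\<sigma> y)) \<and>
           (\<forall>b. Neg x b \<in> ante \<rho> \<longrightarrow> \<not> (\<exists>p. step G (\<sigma> x) b p))) \<and>
        q = subst \<sigma> (target \<rho>))"

end

definition bisimulation :: "('f, 'v, 'a) gsos \<Rightarrow> (('f, 'v) trm \<times> ('f, 'v) trm) set \<Rightarrow> bool" where
  "bisimulation G B \<longleftrightarrow>
     B \<subseteq> closed_terms G \<times> closed_terms G \<and> sym B \<and>
     (\<forall>p q a p'. (p, q) \<in> B \<and> step G p a p' \<longrightarrow> (\<exists>q'. step G q a q' \<and> (p', q') \<in> B))"

definition bisimilar :: "('f, 'v, 'a) gsos \<Rightarrow> (('f, 'v) trm \<times> ('f, 'v) trm) set" where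
  "bisimilar G = \<Union> {B. bisimulation G B}"

definition valid_equation :: "('f, 'v, 'a) gsos \<Rightarrow> ('f, 'v) trm \<Rightarrow> ('f, 'v) trm \<Rightarrow> bool" where
  "valid_equation G P Q \<longleftrightarrow>
     (\<forall>\<sigma>. closed_subst G \<sigma> \<longrightarrow> (subst \<sigma> P, subst \<sigma> Q) \<in> bisimilar G)"


lemma bisimulation_bisimilar: "bisimulation G (bisimilar G)"
  unfolding bisimulation_def bisimilar_def sym_def by blast

lemma bisimilar_greatest: "bisimulation G B \<Longrightarrow> B \<subseteq> bisimilar G"
  by (auto simp: bisimilar_def)


section \<open>Sound and supporting sets of ruloids\<close>

primrec sat_literal :: "('f, 'v, 'a) gsos \<Rightarrow> ('v \<Rightarrow> ('f, 'v) trm) \<Rightarrow> ('v, 'a) literal \<Rightarrow> bool" where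
  "sat_literal G \<sigma> (Pos x a y) \<longleftrightarrow> step G (\<sigma> x) a (\<sigma> y)"
| "sat_literal G \<sigma> (Neg x b) \<longleftrightarrow> \<not> (\<exists>p. step G (\<sigma> x) b p)"

definition sat_ante :: "('f, 'v, 'a) gsos \<Rightarrow> ('v \<Rightarrow> ('f, 'v) trm) \<Rightarrow> ('f, 'v, 'a) ruloid \<Rightarrow> bool" where
  "sat_ante G \<sigma> \<rho> \<longleftrightarrow> (\<forall>l \<in> ante \<rho>. sat_literal G \<sigma> l)"

definition sound_ruloid :: "('f, 'v, 'a) gsos \<Rightarrow> ('f, 'v, 'a) ruloid \<Rightarrow> bool" where
  "sound_ruloid G \<rho> \<longleftrightarrow>
     (\<forall>\<sigma>. closed_subst G \<sigma> \<and> sat_ante G \<sigma> \<rho> \<longrightarrow>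
          step G (subst \<sigma> (source \<rho>)) (label \<rho>) (subst \<sigma> (target \<rho>)))"

definition supports ::
  "('f, 'v, 'a) gsos \<Rightarrow> ('f, 'v, 'a) ruloid \<Rightarrow> ('f, 'v) trm \<Rightarrow> 'a \<Rightarrow> ('f, 'v) trm \<Rightarrow> bool" where
  "supports G \<rho> p c q \<longleftrightarrow>
     (\<exists>\<sigma>. closed_subst G \<sigma> \<and> sat_ante G \<sigma> \<rho> \<and>
          subst \<sigma> (source \<rho>) = p \<and> label \<rho> = c \<and> subst \<sigma> (target \<rho>) = q)"

text \<open>The defining property of the transition relation, without the guards.\<close>

lemma step_iff_rule:
  assumes "gsos_language G"
  shows "step G (Op f ps) c q \<longleftrightarrow> (\<exists>\<rho> \<in> rules G. supports G \<rho> (Op f ps) c q)"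
proof -
  have "(\<exists>xs. source \<rho> = Op f (map Var xs) \<and> label \<rho> = c \<and> closed_subst G \<sigma> \<and> ps = map \<sigma> xs \<and>
          (\<forall>x \<in> set xs.
             (\<forall>a y. Pos x a y \<in> ante \<rho> \<longrightarrow> step G (\<sigma> x) a (\<sigma> y)) \<and>
             (\<forall>b. Neg x b \<in> ante \<rho> \<longrightarrow> \<not> (\<exists>p. step G (\<sigma> x) b p))) \<and>
          q = subst \<sigma> (target \<rho>)) \<longleftrightarrow>
        closed_subst G \<sigma> \<and> sat_ante G \<sigma> \<rho> \<and>
          subst \<sigma> (source \<rho>) = Op f ps \<and> label \<rho> = c \<and> subst \<sigma> (target \<rho>) = q"
    (is "?L \<longleftrightarrow> ?R") if "\<rho> \<in> rules G" for \<rho> \<sigma>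
  proof -
    from assms that obtain g xs where src: "source \<rho> = Op g (map Var xs)"
      and rul: "ruloid_for G (Op g (map Var xs)) \<rho>"
      unfolding gsos_language_def gsos_rule_def ruloid_for_def by blast
    have sv: "sourcevars \<rho> = set xs" by (simp add: sourcevars_def src image_image)
    have inj: "map Var xs = map Var ys \<longleftrightarrow> xs = (ys :: 'b list)" for ys
      by (rule inj_map_eq_map) (simp add: inj_def)
    have mp: "map (subst \<sigma> \<circ> Var) xs = map \<sigma> xs" by simp
    have "sat_ante G \<sigma> \<rho> \<longleftrightarrow>
       (\<forall>x \<in> set xs. (\<forall>a y. Pos x a y \<in> ante \<rho> \<longrightarrow> step G (\<sigma> x) a (\<sigma> y)) \<and>
             (\<forall>b. Neg x b \<in> ante \<rho> \<longrightarrow> \<not> (\<exists>p. step G (\<sigma> x) b p)))" (is "_ \<longleftrightarrow> ?A")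
    proof
      assume "sat_ante G \<sigma> \<rho>"
      then show ?A unfolding sat_ante_def
        by (metis sat_literal.simps)
    next
      assume A: ?A
      show "sat_ante G \<sigma> \<rho>" unfolding sat_ante_def
      proof
        fix l assume "l \<in> ante \<rho>"
        moreover have "x \<in> set xs" if "Pos x a y \<in> ante \<rho>" for x a y
          using rul that unfolding ruloid_for_def sv by blast
        moreover have "x \<in> set xs" if "Neg x b \<in> ante \<rho>" for x b
          using rul that unfolding ruloid_for_def sv by blast
        ultimately show "sat_literal G \<sigma> l"
          using A by (cases l) (metis sat_literal.simps)+
      qed
    qed
    then show ?thesis by (auto simp: src inj)
  qed
  then show ?thesis by (simp add: supports_def) blast
qed

definition supporting ::
  "('f, 'v, 'a) gsos \<Rightarrow> ('f, 'v) trm \<Rightarrow> 'a \<Rightarrow> ('f, 'v, 'a) ruloid set \<Rightarrow> bool" where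
  "supporting G D c R \<longleftrightarrow>
     (\<forall>\<rho> \<in> R. source \<rho> = D \<and> label \<rho> = c) \<and>
     (\<forall>\<sigma> p. closed_subst G \<sigma> \<and> step G (subst \<sigma> D) c p \<longrightarrow>
            (\<exists>\<rho> \<in> R. supports G \<rho> (subst \<sigma> D) c p))"

definition junk :: "('f, 'v, 'a) gsos \<Rightarrow> ('f, 'v, 'a) ruloid \<Rightarrow> bool" where
  "junk G \<rho> \<longleftrightarrow> \<not> (\<exists>p c q. step G p c q \<and> supports G \<rho> p c q)"

definition ruloid_assignment ::
  "('f, 'v, 'a) gsos \<Rightarrow> (('f, 'v) trm \<Rightarrow> ('f, 'v, 'a) ruloid set) \<Rightarrow> bool" where
  "ruloid_assignment G ruloids \<longleftrightarrow>
     (\<forall>P \<in> Terms G. \<exists>R.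
        (\<forall>c. finite (R c) \<and> (\<forall>\<rho> \<in> R c. ruloid_for G P \<rho> \<and> sound_ruloid G \<rho>) \<and>
             supporting G P c (R c)) \<and>
        ruloids P = (\<Union>c. R c))"

definition rename_literal :: "('v \<Rightarrow> 'v) \<Rightarrow> ('v, 'a) literal \<Rightarrow> ('v, 'a) literal" where
  "rename_literal r = map_literal r id"

definition rename_ruloid :: "('v \<Rightarrow> 'v) \<Rightarrow> ('f, 'v, 'a) ruloid \<Rightarrow> ('f, 'v, 'a) ruloid" where
  "rename_ruloid r \<rho> =
     \<lparr>ante = rename_literal r ` ante \<rho>, source = subst (Var \<circ> r) (source \<rho>),
      label = label \<rho>, target = subst (Var \<circ> r) (target \<rho>)\<rparr>"

text \<open>
  The renaming \<open>\<sigma>\<close> of the definition has domain \<open>targetvars \<rho>'\<close>; applied to a ruloid it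
  leaves all other variables unchanged.
\<close>

definition valid_ruloid ::
  "(('f, 'v) trm \<Rightarrow> ('f, 'v, 'a) ruloid set) \<Rightarrow> ('f, 'v) trm \<Rightarrow> ('f, 'v, 'a) ruloid \<Rightarrow> bool" where
  "valid_ruloid ruloids P \<rho> \<longleftrightarrow> source \<rho> = P \<and>
     (\<exists>\<rho>' \<in> ruloids P. \<exists>\<sigma>. inj_on \<sigma> (targetvars \<rho>') \<and>
        \<sigma> ` targetvars \<rho>' \<subseteq> - sourcevars \<rho> \<and>
        \<rho> = rename_ruloid (\<lambda>x. if x \<in> targetvars \<rho>' then \<sigma> x else x) \<rho>')"


section \<open>Initial transition formulae\<close>

datatype ('v, 'a) formula =
    FTrue
  | Init 'v 'a
  | FNot "('v, 'a) formula"
  | FAnd "('v, 'a) formula" "('v, 'a) formula"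

primrec sat :: "('f, 'v, 'a) gsos \<Rightarrow> ('v \<Rightarrow> ('f, 'v) trm) \<Rightarrow> ('v, 'a) formula \<Rightarrow> bool" where
  "sat G \<sigma> FTrue \<longleftrightarrow> True"
| "sat G \<sigma> (Init x a) \<longleftrightarrow> (\<exists>p. step G (\<sigma> x) a p)"
| "sat G \<sigma> (FNot F) \<longleftrightarrow> \<not> sat G \<sigma> F"
| "sat G \<sigma> (FAnd F F') \<longleftrightarrow> sat G \<sigma> F \<and> sat G \<sigma> F'"

definition entails :: "('f, 'v, 'a) gsos \<Rightarrow> ('v, 'a) formula \<Rightarrow> ('v, 'a) formula \<Rightarrow> bool" where
  "entails G F F' \<longleftrightarrow> (\<forall>\<sigma>. closed_subst G \<sigma> \<and> sat G \<sigma> F \<longrightarrow> sat G \<sigma> F')"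

abbreviation FOr :: "('v, 'a) formula \<Rightarrow> ('v, 'a) formula \<Rightarrow> ('v, 'a) formula" where
  "FOr F F' \<equiv> FNot (FAnd (FNot F) (FNot F'))"

text \<open>
  Conjunctions and disjunctions over a finite set are formed along an arbitrary enumeration of
  the set; different enumerations give logically equivalent formulae.  The empty disjunction is
  \<open>FNot FTrue\<close>.
\<close>

definition enumeration :: "'b set \<Rightarrow> 'b list" where
  "enumeration A = (SOME xs. set xs = A \<and> distinct xs)"

definition Conj :: "('b \<Rightarrow> ('v, 'a) formula) \<Rightarrow> 'b set \<Rightarrow> ('v, 'a) formula" where
  "Conj F A = foldr (\<lambda>x. FAnd (F x)) (enumeration A) FTrue"

definition Disj :: "('b \<Rightarrow> ('v, 'a) formula) \<Rightarrow> 'b set \<Rightarrow> ('v, 'a) formula" where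
  "Disj F A = foldr (\<lambda>x. FOr (F x)) (enumeration A) (FNot FTrue)"

primrec literal_hyp :: "('v, 'a) literal \<Rightarrow> ('v, 'a) formula" where
  "literal_hyp (Pos x a y) = Init x a"
| "literal_hyp (Neg x b) = FNot (Init x b)"

definition hyps :: "('v, 'a) literal set \<Rightarrow> ('v, 'a) formula" where
  "hyps H = Conj literal_hyp H"

definition hyps_ruloids :: "('f, 'v, 'a) ruloid set \<Rightarrow> ('v, 'a) formula" where
  "hyps_ruloids J = Disj (\<lambda>\<rho>. hyps (ante \<rho>)) J"

lemma enumeration:
  assumes "finite A"
  shows "set (enumeration A) = A" and "distinct (enumeration A)"
proof -
  have "\<exists>xs. set xs = A \<and> distinct xs"
    using finite_distinct_list[OF assms] by blast
  then have "set (enumeration A) = A \<and> distinct (enumeration A)"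
    unfolding enumeration_def by (rule someI_ex)
  then show "set (enumeration A) = A" and "distinct (enumeration A)" by auto
qed

lemma sat_Conj: "finite A \<Longrightarrow> sat G \<sigma> (Conj F A) \<longleftrightarrow> (\<forall>x \<in> A. sat G \<sigma> (F x))"
proof -
  have "sat G \<sigma> (foldr (\<lambda>x. FAnd (F x)) xs FTrue) \<longleftrightarrow> (\<forall>x \<in> set xs. sat G \<sigma> (F x))" for xs
    by (induction xs) auto
  then show "finite A \<Longrightarrow> ?thesis" by (simp add: Conj_def enumeration(1))
qed

lemma sat_Disj: "finite A \<Longrightarrow> sat G \<sigma> (Disj F A) \<longleftrightarrow> (\<exists>x \<in> A. sat G \<sigma> (F x))"
proof -
  have "sat G \<sigma> (foldr (\<lambda>x. FOr (F x)) xs (FNot FTrue)) \<longleftrightarrow> (\<exists>x \<in> set xs. sat G \<sigma> (F x))" for xs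
    by (induction xs) auto
  then show "finite A \<Longrightarrow> ?thesis" by (simp add: Disj_def enumeration(1))
qed


section \<open>Rule-matching bisimilarity\<close>

definition rm_bisimulation ::
  "('f, 'v, 'a) gsos \<Rightarrow> (('f, 'v) trm \<Rightarrow> ('f, 'v, 'a) ruloid set) \<Rightarrow>
   (('f, 'v) trm \<times> ('f, 'v) trm) set \<Rightarrow> bool" where
  "rm_bisimulation G ruloids B \<longleftrightarrow>
     B \<subseteq> Terms G \<times> Terms G \<and> sym B \<and>
     (\<forall>P Q. (P, Q) \<in> B \<longrightarrow>
       (\<forall>\<rho> \<in> ruloids P. \<exists>J. finite J \<and> (\<forall>\<rho>' \<in> J. valid_ruloid ruloids Q \<rho>') \<and>
          (\<forall>\<rho>' \<in> J.
             label \<rho>' = label \<rho> \<and>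
             (target \<rho>, target \<rho>') \<in> B \<and>
             (targetvars \<rho>' \<union> targetvars \<rho>) \<inter> (sourcevars \<rho> \<union> sourcevars \<rho>') = {} \<and>
             (\<forall>y \<in> targetvars \<rho> \<inter> targetvars \<rho>'.
                \<exists>x \<in> sourcevars \<rho> \<inter> sourcevars \<rho>'. \<exists>b. Pos x b y \<in> ante \<rho> \<inter> ante \<rho>')) \<and>
          entails G (hyps (ante \<rho>)) (hyps_ruloids J)))"

definition rm_bisimilar ::
  "('f, 'v, 'a) gsos \<Rightarrow> (('f, 'v) trm \<Rightarrow> ('f, 'v, 'a) ruloid set) \<Rightarrow>
   ('f, 'v) trm \<Rightarrow> ('f, 'v) trm \<Rightarrow> bool" where
  "rm_bisimilar G ruloids P Q \<longleftrightarrow> (\<exists>B. rm_bisimulation G ruloids B \<and> (P, Q) \<in> B)"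

end

(* If \<approx> is a rule-matching bisimulation, then {(P\<sigma>, Q\<sigma>) | P \<approx> Q, \<sigma> closed} is a bisimulation.
   A transition of P\<sigma> instantiates a ruloid \<rho> for P by some \<sigma>' agreeing with \<sigma> on the variables of P.
   The entailment, evaluated at \<sigma>, selects a matching valid ruloid \<rho>' for Q whose hypotheses hold
   initially.  The substitution \<tau> that is \<sigma>' on the target variables of \<rho>, a chosen witness on the
   remaining target variables of \<rho>', and \<sigma> elsewhere then satisfies the antecedents of both ruloids,
   because shared target variables stem from the same antecedent. *)
theory Submission
  imports Defs
begin

section \<open>Substitutions and closed terms\<close>

lemma subst_cong: "(\<And>x. x \<in> vars t \<Longrightarrow> \<sigma> x = \<tau> x) \<Longrightarrow> subst \<sigma> t = subst \<tau> t"
  by (induction t) auto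

lemma subst_eq_iff: "subst \<sigma> t = subst \<tau> t \<longleftrightarrow> (\<forall>x \<in> vars t. \<sigma> x = \<tau> x)"
  by (induction t) auto

lemma subst_subst: "subst \<tau> (subst \<sigma> t) = subst (subst \<tau> \<circ> \<sigma>) t"
  by (induction t) auto

lemma vars_subst: "vars (subst \<sigma> t) = (\<Union>x \<in> vars t. vars (\<sigma> x))"
  by (induction t) auto

lemma subst_terms_over:
  assumes "t \<in> terms_over \<Sigma> ar" "\<And>x. \<sigma> x \<in> terms_over \<Sigma> ar"
  shows "subst \<sigma> t \<in> terms_over \<Sigma> ar"
  using assms(1) by induction (auto simp: assms(2) intro!: terms_over.intros)

lemma closed_terms_subst:
  assumes "closed_subst G \<sigma>" "t \<in> Terms G"
  shows "subst \<sigma> t \<in> closed_terms G"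
  using assms by (auto simp: closed_subst_def closed_terms_def vars_subst intro: subst_terms_over)

text \<open>The target of a transition is an instance of a rule target under a closed substitution,
  and a variable has no transitions. Witnesses taken from transitions may therefore serve as values
  of a closed substitution.\<close>

lemma step_closed:
  assumes "gsos_language G" "step G p a q"
  shows "q \<in> closed_terms G"
proof (cases p)
  case (Op f ps)
  then obtain \<rho> \<sigma> where "\<rho> \<in> rules G" "closed_subst G \<sigma>" "subst \<sigma> (target \<rho>) = q"
    using assms step_iff_rule[OF assms(1)] unfolding supports_def by blast
  moreover have "target \<rho> \<in> Terms G"
    using assms(1) \<open>\<rho> \<in> rules G\<close>
    unfolding gsos_language_def gsos_rule_def ruloid_for_def by blast
  ultimately show ?thesis using closed_terms_subst by blast
qed (use assms in simp)

section \<open>Renamed and valid ruloids\<close>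

lemma sat_literal_rename: "sat_literal G \<tau> (rename_literal r l) = sat_literal G (\<tau> \<circ> r) l"
  by (cases l) (simp_all add: rename_literal_def)

lemma sat_ante_rename: "sat_ante G \<tau> (rename_ruloid r \<rho>) = sat_ante G (\<tau> \<circ> r) \<rho>"
  by (simp add: sat_ante_def rename_ruloid_def sat_literal_rename)

lemma subst_rename: "subst \<tau> (subst (Var \<circ> r) t) = subst (\<tau> \<circ> r) t"
  unfolding subst_subst by (rule subst_cong) simp

text \<open>Instantiating the renamed ruloid by \<open>\<tau>\<close> amounts to instantiating the
  original by \<open>\<tau> \<circ> r\<close>, which is again closed.\<close>

lemma sound_ruloid_rename:
  assumes "sound_ruloid G \<rho>"
  shows "sound_ruloid G (rename_ruloid r \<rho>)"
  unfolding sound_ruloid_def sat_ante_rename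
proof (intro allI impI, elim conjE)
  fix \<tau> assume "closed_subst G \<tau>" "sat_ante G (\<tau> \<circ> r) \<rho>"
  moreover have "closed_subst G (\<tau> \<circ> r)" using \<open>closed_subst G \<tau>\<close> by (simp add: closed_subst_def)
  ultimately show "step G (subst \<tau> (source (rename_ruloid r \<rho>))) (label (rename_ruloid r \<rho>))
      (subst \<tau> (target (rename_ruloid r \<rho>)))"
    using assms by (simp add: sound_ruloid_def rename_ruloid_def subst_rename)
qed

lemma Pos_in_rename:
  "Pos x a y \<in> ante (rename_ruloid r \<rho>) \<longleftrightarrow> (\<exists>x' y'. Pos x' a y' \<in> ante \<rho> \<and> x = r x' \<and> y = r y')"
proof -
  have "Pos x a y = rename_literal r l \<longleftrightarrow> (\<exists>x' y'. l = Pos x' a y' \<and> x = r x' \<and> y = r y')" for l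
    by (cases l) (auto simp: rename_literal_def)
  then show ?thesis by (auto simp: rename_ruloid_def image_iff)
qed

lemma Neg_in_rename:
  "Neg x b \<in> ante (rename_ruloid r \<rho>) \<longleftrightarrow> (\<exists>x'. Neg x' b \<in> ante \<rho> \<and> x = r x')"
proof -
  have "Neg x b = rename_literal r l \<longleftrightarrow> (\<exists>x'. l = Neg x' b \<and> x = r x')" for l
    by (cases l) (auto simp: rename_literal_def)
  then show ?thesis by (auto simp: rename_ruloid_def image_iff)
qed

lemma valid_ruloid_sound:
  assumes "valid_ruloid ruloids Q \<rho>" "\<And>\<rho>. \<rho> \<in> ruloids Q \<Longrightarrow> sound_ruloid G \<rho>"
  shows "sound_ruloid G \<rho>"
  using assms sound_ruloid_rename unfolding valid_ruloid_def by blast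

text \<open>Only target variables get renamed. Injectivity of the renaming keeps the antecedent of
  each target variable unique, and its avoidance of the source variables keeps both kinds of
  variables apart.\<close>

lemma valid_ruloid_ruloid_for:
  assumes "valid_ruloid ruloids Q \<rho>" "\<And>\<rho>. \<rho> \<in> ruloids Q \<Longrightarrow> ruloid_for G Q \<rho>"
  shows "ruloid_for G Q \<rho>"
proof -
  from assms(1) obtain \<rho>0 \<sigma> where src: "source \<rho> = Q" and "\<rho>0 \<in> ruloids Q"
    and inj: "inj_on \<sigma> (targetvars \<rho>0)" and fresh: "\<sigma> ` targetvars \<rho>0 \<subseteq> - sourcevars \<rho>"
    and ren: "\<rho> = rename_ruloid (\<lambda>x. if x \<in> targetvars \<rho>0 then \<sigma> x else x) \<rho>0"
    unfolding valid_ruloid_def by blast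
  define r where "r = (\<lambda>x. if x \<in> targetvars \<rho>0 then \<sigma> x else x)"
  have ren: "\<rho> = rename_ruloid r \<rho>0" using ren by (simp add: r_def)
  have r0: "ruloid_for G Q \<rho>0" using assms(2) \<open>\<rho>0 \<in> ruloids Q\<close> .
  then have sv: "sourcevars \<rho>0 = vars Q" "sourcevars \<rho> = vars Q"
    by (simp_all add: sourcevars_def ruloid_for_def src)
  \<comment> \<open>Source variables of \<open>\<rho>0\<close> are not among its target variables,
    so \<open>r\<close> fixes them.\<close>
  have r_src: "r x = x" if "x \<in> vars Q" for x
    using r0 that sv(1) unfolding r_def ruloid_for_def by auto
  have r_inj: "inj_on r (targetvars \<rho>0)" using inj by (simp add: r_def inj_on_def)
  have tv: "targetvars \<rho> = r ` targetvars \<rho>0"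
    by (auto simp: targetvars_def ren Pos_in_rename)
  have pos: "x \<in> vars Q \<and> (\<exists>y'. Pos x a y' \<in> ante \<rho>0 \<and> y' \<in> targetvars \<rho>0 \<and> y = r y')"
    if Pos: "Pos x a y \<in> ante \<rho>" for x a y
  proof -
    obtain x' y' where "Pos x' a y' \<in> ante \<rho>0" "x = r x'" "y = r y'"
      using Pos Pos_in_rename[of x a y r \<rho>0] unfolding ren by blast
    moreover have "x' \<in> vars Q" using r0 calculation(1) sv unfolding ruloid_for_def by blast
    ultimately show ?thesis using r_src by (auto simp: targetvars_def)
  qed
  have neg: "x \<in> vars Q" if Neg: "Neg x b \<in> ante \<rho>" for x b
  proof -
    obtain x' where "Neg x' b \<in> ante \<rho>0" "x = r x'"
      using Neg Neg_in_rename[of x b r \<rho>0] unfolding ren by blast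
    moreover have "x' \<in> vars Q" using r0 calculation(1) sv unfolding ruloid_for_def by blast
    ultimately show ?thesis using r_src by simp
  qed
  have uniq: "x = x' \<and> a = a'" if Pos: "Pos x a y \<in> ante \<rho>" "Pos x' a' y \<in> ante \<rho>" for x a x' a' y
  proof -
    obtain z where z: "Pos x a z \<in> ante \<rho>0" "z \<in> targetvars \<rho>0" "y = r z"
      using pos[OF Pos(1)] by blast
    obtain z' where z': "Pos x' a' z' \<in> ante \<rho>0" "z' \<in> targetvars \<rho>0" "y = r z'"
      using pos[OF Pos(2)] by blast
    \<comment> \<open>Injectivity of \<open>r\<close> on target variables traces both antecedents
      back to a single target variable of \<open>\<rho>0\<close>.\<close>
    have "z = z'" using r_inj z z' by (simp add: inj_on_def)
    then show ?thesis using r0 z(1) z'(1) unfolding ruloid_for_def by blast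
  qed
  have "finite (ante \<rho>)" using r0 by (simp add: ren rename_ruloid_def ruloid_for_def)
  moreover have "sourcevars \<rho> \<inter> targetvars \<rho> = {}" using fresh by (auto simp: tv r_def)
  moreover have "target \<rho> \<in> Terms G"
    using r0 by (auto simp: ren rename_ruloid_def ruloid_for_def
        intro!: subst_terms_over terms_over.intros(1))
  moreover have "vars (target \<rho>) \<subseteq> sourcevars \<rho> \<union> targetvars \<rho>"
  proof -
    have "vars (target \<rho>) = r ` vars (target \<rho>0)"
      by (auto simp: ren rename_ruloid_def vars_subst)
    also have "\<dots> \<subseteq> r ` (vars Q \<union> targetvars \<rho>0)"
      using r0 sv(1) unfolding ruloid_for_def by auto
    also have "\<dots> = sourcevars \<rho> \<union> targetvars \<rho>" using r_src by (auto simp: sv tv image_Un)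
    finally show ?thesis .
  qed
  ultimately show ?thesis
    unfolding ruloid_for_def using src pos neg uniq sv(2) by blast
qed

section \<open>Antecedents and their initial hypotheses\<close>

lemma sat_hyps_iff:
  assumes "finite H"
  shows "sat G \<sigma> (hyps H) \<longleftrightarrow>
    (\<forall>x a y. Pos x a y \<in> H \<longrightarrow> (\<exists>p. step G (\<sigma> x) a p)) \<and>
    (\<forall>x b. Neg x b \<in> H \<longrightarrow> \<not> (\<exists>p. step G (\<sigma> x) b p))" (is "_ \<longleftrightarrow> ?R")
proof -
  have "(\<forall>l \<in> H. sat G \<sigma> (literal_hyp l)) \<longleftrightarrow> ?R"
  proof
    assume "\<forall>l \<in> H. sat G \<sigma> (literal_hyp l)"
    then show ?R by force
  next
    assume R: ?R
    show "\<forall>l \<in> H. sat G \<sigma> (literal_hyp l)"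
    proof
      fix l assume "l \<in> H"
      then show "sat G \<sigma> (literal_hyp l)" using R by (cases l) auto
    qed
  qed
  then show ?thesis unfolding hyps_def sat_Conj[OF assms] .
qed

text \<open>Stated parallel to \<open>sat_hyps_iff\<close> to isolate the difference: there the
  target of a positive antecedent is existentially quantified, here it must be
  \<open>\<sigma> y\<close>.\<close>

lemma sat_ante_iff:
  "sat_ante G \<sigma> \<rho> \<longleftrightarrow>
    (\<forall>x a y. Pos x a y \<in> ante \<rho> \<longrightarrow> step G (\<sigma> x) a (\<sigma> y)) \<and>
    (\<forall>x b. Neg x b \<in> ante \<rho> \<longrightarrow> \<not> (\<exists>p. step G (\<sigma> x) b p))" (is "_ \<longleftrightarrow> ?R")
proof
  assume "sat_ante G \<sigma> \<rho>"
  then show ?R unfolding sat_ante_def by force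
next
  assume R: ?R
  show "sat_ante G \<sigma> \<rho>" unfolding sat_ante_def
  proof
    fix l assume "l \<in> ante \<rho>"
    then show "sat_literal G \<sigma> l" using R by (cases l) auto
  qed
qed

section \<open>Transfer of transitions along a rule-matching bisimulation\<close>

lemma ruloid_assignment_ruloid:
  assumes "ruloid_assignment G ruloids" "P \<in> Terms G" "\<rho> \<in> ruloids P"
  shows "ruloid_for G P \<rho>" and "sound_ruloid G \<rho>"
  using assms unfolding ruloid_assignment_def by blast+

lemma ruloid_assignment_supports:
  assumes "ruloid_assignment G ruloids" "P \<in> Terms G"
    and "closed_subst G \<sigma>" "step G (subst \<sigma> P) a p"
  shows "\<exists>\<rho> \<in> ruloids P. supports G \<rho> (subst \<sigma> P) a p"
  using assms unfolding ruloid_assignment_def supporting_def by blast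

text \<open>A pair of target instances belongs to the candidate bisimulation only if one closed
  substitution produces both. So \<open>\<tau>\<close> has to reproduce the given instance of
  \<open>target \<rho>\<close> and at the same time make \<open>\<rho>'\<close> fire.\<close>

lemma matching_subst:
  assumes G: "gsos_language G"
    and \<sigma>: "closed_subst G \<sigma>" and \<sigma>': "closed_subst G \<sigma>'"
    and \<rho>: "ruloid_for G P \<rho>" and \<rho>': "ruloid_for G Q \<rho>'"
    and agree: "\<And>x. x \<in> vars P \<Longrightarrow> \<sigma>' x = \<sigma> x"
    and ante: "sat_ante G \<sigma>' \<rho>" and hyps: "sat G \<sigma> (hyps (ante \<rho>'))"
    and disj: "(targetvars \<rho>' \<union> targetvars \<rho>) \<inter> (sourcevars \<rho> \<union> sourcevars \<rho>') = {}"
    and shared: "\<forall>y \<in> targetvars \<rho> \<inter> targetvars \<rho>'.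
                \<exists>x \<in> sourcevars \<rho> \<inter> sourcevars \<rho>'. \<exists>b. Pos x b y \<in> ante \<rho> \<inter> ante \<rho>'"
  obtains \<tau> where "closed_subst G \<tau>" "sat_ante G \<tau> \<rho>'"
    "subst \<tau> Q = subst \<sigma> Q" "subst \<tau> (target \<rho>) = subst \<sigma>' (target \<rho>)"
proof -
  have sv: "sourcevars \<rho> = vars P" "sourcevars \<rho>' = vars Q"
    using \<rho> \<rho>' by (simp_all add: sourcevars_def ruloid_for_def)
  have fin: "finite (ante \<rho>')" using \<rho>' unfolding ruloid_for_def by blast
  have pos: "\<exists>p. step G (\<sigma> x) a p" if "Pos x a y \<in> ante \<rho>'" for x a y
    using hyps that unfolding sat_hyps_iff[OF fin] by blast
  have neg: "\<not> (\<exists>p. step G (\<sigma> x) b p)" if "Neg x b \<in> ante \<rho>'" for x b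
    using hyps that unfolding sat_hyps_iff[OF fin] by blast
  have uniq: "x = x' \<and> a = a'" if "Pos x a y \<in> ante \<rho>'" "Pos x' a' y \<in> ante \<rho>'" for x a x' a' y
    using \<rho>' that unfolding ruloid_for_def by blast
  have src: "x \<in> vars Q" if "Pos x a y \<in> ante \<rho>' \<or> Neg x a \<in> ante \<rho>'" for x a y
    using \<rho>' that sv(2) unfolding ruloid_for_def by blast
  \<comment> \<open>One \<open>p\<close> has to serve every antecedent with target \<open>y\<close>;
    by \<open>uniq\<close> there is only one such antecedent.\<close>
  have "\<forall>y \<in> targetvars \<rho>'. \<exists>p. \<forall>x a. Pos x a y \<in> ante \<rho>' \<longrightarrow> step G (\<sigma> x) a p"
  proof
    fix y assume "y \<in> targetvars \<rho>'"
    then obtain x a where "Pos x a y \<in> ante \<rho>'" unfolding targetvars_def by blast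
    then show "\<exists>p. \<forall>x a. Pos x a y \<in> ante \<rho>' \<longrightarrow> step G (\<sigma> x) a p"
      using pos uniq by blast
  qed
  then obtain w where w: "\<And>x a y. Pos x a y \<in> ante \<rho>' \<Longrightarrow> step G (\<sigma> x) a (w y)"
    unfolding bchoice_iff targetvars_def by blast
  \<comment> \<open>Testing \<open>targetvars \<rho>\<close> first gives shared target variables the
    value under \<open>\<sigma>'\<close>, which the instance of \<open>target \<rho>\<close>
    dictates.\<close>
  define \<tau> where "\<tau> x = (if x \<in> targetvars \<rho> then \<sigma>' x
     else if x \<in> targetvars \<rho>' then w x else \<sigma> x)" for x
  \<comment> \<open>By \<open>disj\<close>, a source variable of either ruloid is a target variable
    of neither, so the last branch applies.\<close>
  have \<tau>_src: "\<tau> x = \<sigma> x" if "x \<in> vars P \<union> vars Q" for x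
    using disj that unfolding sv \<tau>_def by auto
  show ?thesis
  proof
    show "closed_subst G \<tau>"
      using \<sigma> \<sigma>' step_closed[OF G w] unfolding closed_subst_def \<tau>_def targetvars_def by auto
    have "step G (\<tau> x) a (\<tau> y)" if xy: "Pos x a y \<in> ante \<rho>'" for x a y
    proof (cases "y \<in> targetvars \<rho>")
      case True
      moreover have "y \<in> targetvars \<rho>'" using xy unfolding targetvars_def by blast
      ultimately obtain x' b where "x' \<in> vars P" "Pos x' b y \<in> ante \<rho>" "Pos x' b y \<in> ante \<rho>'"
        using shared sv(1) by blast
      \<comment> \<open>The common antecedent supplied by \<open>shared\<close> is the one under
        consideration. It holds under \<open>\<sigma>'\<close>, which agrees with
        \<open>\<sigma>\<close> at its source variable.\<close>
      moreover have "x' = x" "b = a" using uniq calculation(3) xy by blast+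
      ultimately have "step G (\<sigma> x) a (\<sigma>' y)"
        using ante agree unfolding sat_ante_iff by metis
      then show ?thesis using True \<tau>_src[of x] src[of x a y] xy by (simp add: \<tau>_def[of y])
    next
      case False
      moreover have "y \<in> targetvars \<rho>'" using xy unfolding targetvars_def by blast
      ultimately show ?thesis
        using w[OF xy] \<tau>_src[of x] src[of x a y] xy by (simp add: \<tau>_def[of y])
    qed
    moreover have "\<not> (\<exists>p. step G (\<tau> x) b p)" if "Neg x b \<in> ante \<rho>'" for x b
      using neg[OF that] \<tau>_src[of x] src[of x b] that by simp
    ultimately show "sat_ante G \<tau> \<rho>'" unfolding sat_ante_iff by blast
    show "subst \<tau> Q = subst \<sigma> Q" using \<tau>_src by (intro subst_cong) blast
    show "subst \<tau> (target \<rho>) = subst \<sigma>' (target \<rho>)"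
    proof (rule subst_cong)
      fix x assume "x \<in> vars (target \<rho>)"
      \<comment> \<open>On target variables of \<open>\<rho>\<close> the first branch of
        \<open>\<tau>\<close> is \<open>\<sigma>'\<close>; on variables of \<open>P\<close> both
        equal \<open>\<sigma>\<close>.\<close>
      then have "x \<in> targetvars \<rho> \<or> x \<in> vars P"
        using \<rho> sv(1) unfolding ruloid_for_def by blast
      then show "\<tau> x = \<sigma>' x"
        using \<tau>_src[of x] agree[of x] by (cases "x \<in> targetvars \<rho>") (simp_all add: \<tau>_def[of x])
    qed
  qed
qed

lemma rm_bisimulation_instances_bisimulation:
  assumes G: "gsos_language G" and R: "ruloid_assignment G ruloids"
    and B: "rm_bisimulation G ruloids B"
  shows "bisimulation G {(subst \<sigma> P, subst \<sigma> Q) | \<sigma> P Q. closed_subst G \<sigma> \<and> (P, Q) \<in> B}"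
    (is "bisimulation G ?I")
proof -
  have sub: "B \<subseteq> Terms G \<times> Terms G" and "sym B" using B unfolding rm_bisimulation_def by blast+
  have "\<exists>q'. step G (subst \<sigma> Q) a q' \<and> (p', q') \<in> ?I"
    if \<sigma>: "closed_subst G \<sigma>" and PQ: "(P, Q) \<in> B" and st: "step G (subst \<sigma> P) a p'"
    for \<sigma> P Q a p'
  proof -
    have P: "P \<in> Terms G" and Q: "Q \<in> Terms G" using PQ sub by auto
    obtain \<rho> \<sigma>' where \<rho>: "\<rho> \<in> ruloids P" and \<sigma>': "closed_subst G \<sigma>'"
      and ante: "sat_ante G \<sigma>' \<rho>" and src: "subst \<sigma>' (source \<rho>) = subst \<sigma> P"
      and lab: "label \<rho> = a" and tgt: "subst \<sigma>' (target \<rho>) = p'"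
      using ruloid_assignment_supports[OF R P \<sigma> st] unfolding supports_def by blast
    note \<rho>_for = ruloid_assignment_ruloid(1)[OF R P \<rho>]
    \<comment> \<open>Equal instances of \<open>P\<close> force the two substitutions to agree on
      its variables; elsewhere \<open>\<sigma>'\<close> may differ from
      \<open>\<sigma>\<close>.\<close>
    have agree: "\<sigma>' x = \<sigma> x" if "x \<in> vars P" for x
      using src \<rho>_for that unfolding ruloid_for_def by (auto simp: subst_eq_iff)
    obtain J where "finite J" and J: "\<forall>\<rho>' \<in> J. valid_ruloid ruloids Q \<rho>'"
      "\<forall>\<rho>' \<in> J.
             label \<rho>' = label \<rho> \<and>
             (target \<rho>, target \<rho>') \<in> B \<and>
             (targetvars \<rho>' \<union> targetvars \<rho>) \<inter> (sourcevars \<rho> \<union> sourcevars \<rho>') = {} \<and>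
             (\<forall>y \<in> targetvars \<rho> \<inter> targetvars \<rho>'.
                \<exists>x \<in> sourcevars \<rho> \<inter> sourcevars \<rho>'. \<exists>b. Pos x b y \<in> ante \<rho> \<inter> ante \<rho>')"
      and ent: "entails G (hyps (ante \<rho>)) (hyps_ruloids J)"
      using B[unfolded rm_bisimulation_def, THEN conjunct2, THEN conjunct2, rule_format, OF PQ \<rho>]
      by (elim exE conjE)
    have fin: "finite (ante \<rho>)" using \<rho>_for unfolding ruloid_for_def by blast
    \<comment> \<open>Hypotheses only test source variables, so their truth carries over from
      \<open>\<sigma>'\<close> to \<open>\<sigma>\<close>.\<close>
    have "\<sigma>' x = \<sigma> x" if "Pos x b y \<in> ante \<rho> \<or> Neg x b \<in> ante \<rho>" for x b y
      using \<rho>_for that agree unfolding ruloid_for_def sourcevars_def by blast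
    then have "sat G \<sigma> (hyps (ante \<rho>))"
      using ante unfolding sat_ante_iff sat_hyps_iff[OF fin] by metis
    \<comment> \<open>Evaluating the entailment at \<open>\<sigma>\<close> rather than
      \<open>\<sigma>'\<close> yields hypotheses about the arguments of \<open>Q\<close> under
      \<open>\<sigma>\<close>, where its transition is needed.\<close>
    then have "sat G \<sigma> (hyps_ruloids J)" using ent \<sigma> unfolding entails_def by blast
    then obtain \<rho>' where \<rho>': "\<rho>' \<in> J" "sat G \<sigma> (hyps (ante \<rho>'))"
      unfolding hyps_ruloids_def sat_Disj[OF \<open>finite J\<close>] by blast
    have valid: "valid_ruloid ruloids Q \<rho>'" using J(1) \<rho>'(1) by blast
    have \<rho>'_for: "ruloid_for G Q \<rho>'"
      using valid ruloid_assignment_ruloid(1)[OF R Q] by (rule valid_ruloid_ruloid_for)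
    have sound: "sound_ruloid G \<rho>'"
      using valid ruloid_assignment_ruloid(2)[OF R Q] by (rule valid_ruloid_sound)
    have J': "label \<rho>' = a" "(target \<rho>, target \<rho>') \<in> B"
      "(targetvars \<rho>' \<union> targetvars \<rho>) \<inter> (sourcevars \<rho> \<union> sourcevars \<rho>') = {}"
      "\<forall>y \<in> targetvars \<rho> \<inter> targetvars \<rho>'.
                \<exists>x \<in> sourcevars \<rho> \<inter> sourcevars \<rho>'. \<exists>b. Pos x b y \<in> ante \<rho> \<inter> ante \<rho>'"
      using J(2) \<rho>'(1) lab by simp_all
    obtain \<tau> where \<tau>: "closed_subst G \<tau>" "sat_ante G \<tau> \<rho>'" "subst \<tau> Q = subst \<sigma> Q"
      "subst \<tau> (target \<rho>) = subst \<sigma>' (target \<rho>)"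
      using matching_subst[OF G \<sigma> \<sigma>' \<rho>_for \<rho>'_for agree ante \<rho>'(2) J'(3,4)] .
    \<comment> \<open>Soundness gives the transition from \<open>subst \<tau> Q\<close>, which is
      the same term as \<open>subst \<sigma> Q\<close>.\<close>
    have "step G (subst \<sigma> Q) a (subst \<tau> (target \<rho>'))"
      using sound \<tau> \<rho>'_for J'(1) unfolding sound_ruloid_def ruloid_for_def by metis
    moreover have "(p', subst \<tau> (target \<rho>')) \<in> ?I" using \<tau>(1) J'(2) \<tau>(4)[unfolded tgt, symmetric] by blast
    ultimately show ?thesis by blast
  qed
  moreover have "?I \<subseteq> closed_terms G \<times> closed_terms G"
    using sub closed_terms_subst by blast
  \<comment> \<open>Swapping a pair of instances keeps the substitution and swaps the underlying
    pair in \<open>B\<close>.\<close>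
  moreover have "sym ?I" using \<open>sym B\<close> unfolding sym_def by blast
  ultimately show ?thesis unfolding bisimulation_def by blast
qed

theorem theorem5p1:
  fixes G :: "('f, 'v::{countable,infinite}, 'a::finite) gsos"
    and ruloids :: "('f, 'v) trm \<Rightarrow> ('f, 'v, 'a) ruloid set"
    and P Q :: "('f, 'v) trm"
  assumes "gsos_language G"
    and "ruloid_assignment G ruloids"
    and "\<forall>\<rho> \<in> rules G. \<not> junk G \<rho>"
    and "\<forall>D \<in> Terms G. \<forall>\<rho> \<in> ruloids D. \<not> junk G \<rho>"
    and "P \<in> Terms G" and "Q \<in> Terms G"
    and "rm_bisimilar G ruloids P Q"
  shows "valid_equation G P Q"
proof -
  obtain B where B: "rm_bisimulation G ruloids B" "(P, Q) \<in> B"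
    using assms(7) unfolding rm_bisimilar_def by blast
  show ?thesis
    unfolding valid_equation_def
    using bisimilar_greatest[OF rm_bisimulation_instances_bisimulation[OF assms(1,2) B(1)]] B(2)
    by blast
qed

end
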